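(* Let $(X,d)$ be a proper geodesic Gromov hyperbolic metric space with approaching geodesics, and let $f\colon X\to X$ be a non-elliptic isometry. Then $\tau(f)=c(f)$.
   Context: A geodesic in $(X,d)$ is a map $\gamma\colon I\to X$ from an interval $I\subset\mathbb{R}$ with $d(\gamma(s),\gamma(t))=|t-s|$ for all $s,t\in I$; it is a geodesic ray if $I=[0,+\infty)$. The space is geodesic if any two points are joined by a geodesic, and proper if closed balls are compact. A proper geodesic metric space is Gromov hyperbolic if there is $\delta\ge 0$ such that in every geodesic triangle each side is contained in the $\delta$-neighborhood of the union of the other two sides. Two geodesic rays $\gamma,\sigma$ are asymptotic if $\sup_{t\ge 0}d(\gamma(t),\sigma(t))<+\infty$, and strongly asymptotic if there exists $T\in\mathbb{R}$ such that $\lim_{t\to+\infty}d(\gamma(t),\sigma(t+T))=0$. The space $X$ has approaching geodesics if any two asymptotic geodesic rays are strongly asymptotic. An isometry of $X$ is a distance-preserving bijection $f\colon X\to X$. It is elliptic if it has a bounded orbit $\{f^n(x)\}_{n\ge 0}$ (equivalently, for proper spaces, all orbits are bounded). The divergence rate is $c(f):=\lim_{n\to+\infty}\frac{d(x,f^n(x))}{n}$, which exists and does not depend on $x\in X$. The minimal displacement is $\tau(f):=\inf_{x\in X}d(x,f(x))$. *)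

theory Defs
  imports "HOL-Analysis.Analysis"
begin

text \<open>
  The metric space \<open>X\<close> is a type of class \<open>metric_space\<close>. Maps defined on an interval \<open>I\<close>
  are represented by functions on all of \<open>real\<close> whose values outside \<open>I\<close> are irrelevant.
\<close>

definition geodesic_on :: "real set \<Rightarrow> (real \<Rightarrow> 'a::metric_space) \<Rightarrow> bool" where
  "geodesic_on I \<gamma> \<longleftrightarrow> is_interval I \<and> (\<forall>s\<in>I. \<forall>t\<in>I. dist (\<gamma> s) (\<gamma> t) = \<bar>t - s\<bar>)"

definition geodesic_ray :: "(real \<Rightarrow> 'a::metric_space) \<Rightarrow> bool" where
  "geodesic_ray \<gamma> \<longleftrightarrow> geodesic_on {0..} \<gamma>"

text \<open>\<open>S\<close> is the image of a geodesic from \<open>x\<close> to \<open>y\<close>; degenerate segments (\<open>x = y\<close>) are allowed.\<close>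

definition geodesic_segment :: "'a::metric_space \<Rightarrow> 'a \<Rightarrow> 'a set \<Rightarrow> bool" where
  "geodesic_segment x y S \<longleftrightarrow>
     (\<exists>a b \<gamma>. a \<le> b \<and> geodesic_on {a..b} \<gamma> \<and> \<gamma> a = x \<and> \<gamma> b = y \<and> S = \<gamma> ` {a..b})"

definition geodesic_space :: "'a::metric_space itself \<Rightarrow> bool" where
  "geodesic_space _ \<longleftrightarrow> (\<forall>x y::'a. \<exists>S. geodesic_segment x y S)"

definition proper_space :: "'a::metric_space itself \<Rightarrow> bool" where
  "proper_space _ \<longleftrightarrow> (\<forall>(x::'a) r. compact (cball x r))"

text \<open>The closed neighbourhood is used, so that \<open>\<delta> = 0\<close> is meaningful.\<close>

definition nbhd :: "real \<Rightarrow> 'a::metric_space set \<Rightarrow> 'a set" where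
  "nbhd \<delta> S = (\<Union>q\<in>S. cball q \<delta>)"

definition geodesic_triangle :: "'a::metric_space set \<Rightarrow> 'a set \<Rightarrow> 'a set \<Rightarrow> bool" where
  "geodesic_triangle A B C \<longleftrightarrow>
     (\<exists>x y z. geodesic_segment x y A \<and> geodesic_segment y z B \<and> geodesic_segment z x C)"

definition gromov_hyperbolic :: "'a::metric_space itself \<Rightarrow> bool" where
  "gromov_hyperbolic _ \<longleftrightarrow>
     (\<exists>\<delta>\<ge>0. \<forall>A B C :: 'a set. geodesic_triangle A B C \<longrightarrow>
        A \<subseteq> nbhd \<delta> (B \<union> C) \<and> B \<subseteq> nbhd \<delta> (C \<union> A) \<and> C \<subseteq> nbhd \<delta> (A \<union> B))"

definition asymptotic :: "(real \<Rightarrow> 'a::metric_space) \<Rightarrow> (real \<Rightarrow> 'a) \<Rightarrow> bool" where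
  "asymptotic \<gamma> \<sigma> \<longleftrightarrow> bdd_above ((\<lambda>t. dist (\<gamma> t) (\<sigma> t)) ` {0..})"

text \<open>\<open>T\<close> may be negative; the limit only involves \<open>\<sigma> (t + T)\<close> for \<open>t + T \<ge> 0\<close>.\<close>

definition strongly_asymptotic :: "(real \<Rightarrow> 'a::metric_space) \<Rightarrow> (real \<Rightarrow> 'a) \<Rightarrow> bool" where
  "strongly_asymptotic \<gamma> \<sigma> \<longleftrightarrow> (\<exists>T. ((\<lambda>t. dist (\<gamma> t) (\<sigma> (t + T))) \<longlongrightarrow> 0) at_top)"

definition approaching_geodesics :: "'a::metric_space itself \<Rightarrow> bool" where
  "approaching_geodesics _ \<longleftrightarrow>
     (\<forall>\<gamma> \<sigma> :: real \<Rightarrow> 'a. geodesic_ray \<gamma> \<and> geodesic_ray \<sigma> \<and> asymptotic \<gamma> \<sigma>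
        \<longrightarrow> strongly_asymptotic \<gamma> \<sigma>)"

definition isometry :: "('a::metric_space \<Rightarrow> 'a) \<Rightarrow> bool" where
  "isometry f \<longleftrightarrow> bij f \<and> (\<forall>x y. dist (f x) (f y) = dist x y)"

definition elliptic :: "('a::metric_space \<Rightarrow> 'a) \<Rightarrow> bool" where
  "elliptic f \<longleftrightarrow> (\<exists>x. bounded (range (\<lambda>n. (f ^^ n) x)))"

text \<open>For an isometry the limit exists and is the same for every base point \<open>x\<close>, so the
  description below denotes this common limit.\<close>

definition divergence_rate :: "('a::metric_space \<Rightarrow> 'a) \<Rightarrow> real" where
  "divergence_rate f = (THE c. \<forall>x. (\<lambda>n. dist x ((f ^^ n) x) / real n) \<longlonglongrightarrow> c)"

definition minimal_displacement :: "('a::metric_space \<Rightarrow> 'a) \<Rightarrow> real" where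
  "minimal_displacement f = (INF x. dist x (f x))"

end

theory Submission
  imports Defs
begin

text \<open>
  A non-elliptic isometry \<open>f\<close> moves some geodesic ray \<open>\<gamma>\<close> to an asymptotic one, in other words it
  fixes a point of the Gromov boundary. To see this, fix \<open>x\<close> and join it to the points
  \<open>(f ^^ n) x\<close>, which are arbitrarily far away because the orbit is unbounded. Since \<open>f\<close> commutes with its
  powers, it moves both endpoints of such a geodesic by the same distance \<open>dist x (f x)\<close>; by
  hyperbolicity it then moves every point of the geodesic by at most a constant independent
  of \<open>n\<close> (\<open>geodesic_quadrilateral\<close>). In a proper space these geodesics accumulate at a
  ray with the same displacement bound (\<open>geodesic_ray_limit\<close>).

  Approaching geodesics turn this bound into a limit: \<open>dist (f (\<gamma> t)) (\<gamma> (t + T))\<close> tends to \<open>0\<close> for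
  some \<open>T\<close>. So, far along the ray, \<open>f\<close> is almost the translation of \<open>\<gamma>\<close> by \<open>T\<close>, and both
  quantities of the theorem equal \<open>\<bar>T\<bar>\<close>. They are at most \<open>\<bar>T\<bar>\<close> because the displacement of \<open>\<gamma> t\<close>
  tends to \<open>\<bar>T\<bar>\<close>. They are at least \<open>\<bar>T\<bar>\<close> because the Busemann function of \<open>\<gamma>\<close>,
  which is \<open>1\<close>-Lipschitz, decreases by exactly \<open>T\<close> under each application
  of \<open>f\<close>, so that \<open>dist y ((f ^^ n) y) \<ge> n * \<bar>T\<bar>\<close> for all \<open>y\<close> and \<open>n\<close>
  (\<open>almost_translated_displacement\<close>).
\<close>

section \<open>Geodesics\<close>

lemma geodesic_onD:
  assumes "geodesic_on I \<gamma>" "s \<in> I" "t \<in> I"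
  shows "dist (\<gamma> s) (\<gamma> t) = \<bar>t - s\<bar>"
  using assms unfolding geodesic_on_def by blast

lemma geodesic_rayD:
  assumes "geodesic_ray \<gamma>" "0 \<le> s" "0 \<le> t"
  shows "dist (\<gamma> s) (\<gamma> t) = \<bar>t - s\<bar>"
  using assms unfolding geodesic_ray_def by (auto intro: geodesic_onD)

lemma geodesic_segment_image:
  assumes "geodesic_on {0..L} \<gamma>" "0 \<le> L"
  shows "geodesic_segment (\<gamma> 0) (\<gamma> L) (\<gamma> ` {0..L})"
  using assms unfolding geodesic_segment_def by blast

lemma geodesic_segment_dist_left:
  assumes "geodesic_segment x y S" "q \<in> S"
  shows "dist x q \<le> dist x y"
proof -
  obtain a b \<gamma> where g: "a \<le> b" "geodesic_on {a..b} \<gamma>" "\<gamma> a = x" "\<gamma> b = y" "S = \<gamma> ` {a..b}"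
    using assms unfolding geodesic_segment_def by blast
  then obtain t where "t \<in> {a..b}" "q = \<gamma> t" using assms by blast
  then show ?thesis
    using g geodesic_onD[OF g(2), of a t] geodesic_onD[OF g(2), of a b] by auto
qed

lemma geodesic_of_length_dist:
  fixes x y :: "'a::metric_space"
  assumes "geodesic_space TYPE('a)"
  obtains \<gamma> :: "real \<Rightarrow> 'a" where "geodesic_on {0..dist x y} \<gamma>" "\<gamma> 0 = x" "\<gamma> (dist x y) = y"
proof -
  obtain S where "geodesic_segment x y S"
    using assms unfolding geodesic_space_def by blast
  then obtain a b \<gamma> where g: "a \<le> b" "geodesic_on {a..b} \<gamma>" "\<gamma> a = x" "\<gamma> b = y"
    unfolding geodesic_segment_def by blast
  have L: "dist x y = b - a"
    using geodesic_onD[OF g(2), of a b] g by auto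
  have "geodesic_on {0..dist x y} (\<lambda>t. \<gamma> (a + t))"
    using g(1,2) unfolding geodesic_on_def L by (auto simp: is_interval_cc)
  then show ?thesis
    using that[of "\<lambda>t. \<gamma> (a + t)"] g L by simp
qed

section \<open>Thin quadrilaterals\<close>

text \<open>
  Cutting the quadrilateral along a diagonal, each point of one long side is within \<open>2 * \<delta>\<close> of the opposite
  side or of one of the short sides. Proximity to the opposite side
  controls the distance at equal times, because the time parameter is the distance to an
  endpoint; proximity to a short side means that the time is close to \<open>0\<close> or \<open>L\<close>.
  The bound depends on the short sides only, not on \<open>L\<close>.
\<close>

lemma geodesic_quadrilateral:
  fixes \<gamma> \<sigma> :: "real \<Rightarrow> 'a::metric_space"
  assumes geo: "geodesic_space TYPE('a)"
    and thin: "\<And>A B C :: 'a set. geodesic_triangle A B C \<Longrightarrow> A \<subseteq> nbhd \<delta> (B \<union> C)"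
    and \<delta>: "0 \<le> \<delta>"
    and \<gamma>: "geodesic_on {0..L} \<gamma>" and \<sigma>: "geodesic_on {0..L} \<sigma>"
    and D0: "dist (\<gamma> 0) (\<sigma> 0) \<le> D" and DL: "dist (\<gamma> L) (\<sigma> L) \<le> D"
    and t: "t \<in> {0..L}"
  shows "dist (\<gamma> t) (\<sigma> t) \<le> 4 * \<delta> + 3 * D"
proof -
  have L: "0 \<le> L" using t by simp
  have D: "0 \<le> D" using D0 zero_le_dist order_trans by blast
  obtain B where B: "geodesic_segment (\<gamma> L) (\<sigma> L) B"
    using geo unfolding geodesic_space_def by blast
  obtain E where E: "geodesic_segment (\<sigma> L) (\<gamma> 0) E"
    using geo unfolding geodesic_space_def by blast
  obtain F where F: "geodesic_segment (\<gamma> 0) (\<sigma> 0) F"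
    using geo unfolding geodesic_space_def by blast
  have t0: "dist (\<gamma> 0) (\<gamma> t) = t" and tL: "dist (\<gamma> L) (\<gamma> t) = L - t"
    and s0: "dist (\<sigma> 0) (\<sigma> t) = t" and sL: "dist (\<sigma> L) (\<sigma> t) = L - t"
    using geodesic_onD[OF \<gamma>, of 0 t] geodesic_onD[OF \<gamma>, of L t]
      geodesic_onD[OF \<sigma>, of 0 t] geodesic_onD[OF \<sigma>, of L t] t by auto
  have "geodesic_triangle (\<gamma> ` {0..L}) B E"
    using geodesic_segment_image[OF \<gamma> L] B E unfolding geodesic_triangle_def by blast
  from thin[OF this] t obtain q where q: "q \<in> B \<union> E" "dist q (\<gamma> t) \<le> \<delta>"
    unfolding nbhd_def by fastforce
  have "geodesic_triangle E F (\<sigma> ` {0..L})"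
    using geodesic_segment_image[OF \<sigma> L] E F unfolding geodesic_triangle_def by blast
  note thin2 = thin[OF this]
  obtain p where p: "p \<in> B \<union> F \<union> \<sigma> ` {0..L}" "dist p (\<gamma> t) \<le> 2 * \<delta>"
  proof (cases "q \<in> B")
    case True
    then show ?thesis using that[of q] q \<delta> by auto
  next
    case False
    then have "q \<in> E" using q by blast
    then obtain p where "p \<in> F \<union> \<sigma> ` {0..L}" "dist p q \<le> \<delta>"
      using thin2 unfolding nbhd_def by fastforce
    then show ?thesis using that[of p] q dist_triangle[of p "\<gamma> t" q] by auto
  qed
  from p(1) consider "p \<in> B" | "p \<in> F" | s where "s \<in> {0..L}" "p = \<sigma> s" by blast
  then show ?thesis
  proof cases
    case 1
    have "L - t \<le> D + 2 * \<delta>"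
      using geodesic_segment_dist_left[OF B 1] DL p(2) tL dist_triangle[of "\<gamma> L" "\<gamma> t" p] by linarith
    then show ?thesis
      using dist_triangle[of "\<gamma> t" "\<sigma> t" "\<gamma> L"] dist_triangle[of "\<gamma> L" "\<sigma> t" "\<sigma> L"] tL sL DL
      by (simp add: dist_commute)
  next
    case 2
    have "t \<le> D + 2 * \<delta>"
      using geodesic_segment_dist_left[OF F 2] D0 p(2) t0 dist_triangle[of "\<gamma> 0" "\<gamma> t" p] by linarith
    then show ?thesis
      using dist_triangle[of "\<gamma> t" "\<sigma> t" "\<gamma> 0"] dist_triangle[of "\<gamma> 0" "\<sigma> t" "\<sigma> 0"] t0 s0 D0
      by (simp add: dist_commute)
  next
    case (3 s)
    have s: "dist (\<sigma> 0) (\<sigma> s) = s" and st: "dist (\<sigma> s) (\<sigma> t) = \<bar>t - s\<bar>"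
      using geodesic_onD[OF \<sigma>, of 0 s] geodesic_onD[OF \<sigma>, of s t] 3 t by auto
    have p': "dist (\<gamma> t) (\<sigma> s) \<le> 2 * \<delta>" using p(2) 3 by (simp add: dist_commute)
    have "t \<le> D + s + 2 * \<delta>"
      using dist_triangle[of "\<gamma> 0" "\<gamma> t" "\<sigma> 0"] dist_triangle[of "\<sigma> 0" "\<gamma> t" "\<sigma> s"] t0 s D0 p'
      by (simp add: dist_commute)
    moreover have "s \<le> D + t + 2 * \<delta>"
      using dist_triangle[of "\<sigma> 0" "\<sigma> s" "\<gamma> 0"] dist_triangle[of "\<gamma> 0" "\<sigma> s" "\<gamma> t"] t0 s D0 p'
      by (simp add: dist_commute)
    ultimately show ?thesis
      using dist_triangle[of "\<gamma> t" "\<sigma> t" "\<sigma> s"] st p' D by linarith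
  qed
qed

section \<open>Limits of long geodesics\<close>

lemma compact_PiE_UNIV:
  fixes K :: "'i \<Rightarrow> 'a::topological_space set"
  assumes "\<And>i. compact (K i)"
  shows "compact (Pi\<^sub>E UNIV K)"
proof -
  have "compactin (product_topology (\<lambda>i. euclidean) UNIV) (Pi\<^sub>E UNIV K)"
    using assms by (simp add: compactin_PiE)
  then show ?thesis
    by (simp add: euclidean_product_topology)
qed

text \<open>
  Being a ray in \<open>S\<close> that starts at \<open>x\<close> is a family of closed conditions, each on two times only, for a
  point of the product of the balls \<open>cball x \<bar>t\<bar>\<close>. The product is compact by Tychonoff's theorem, and
  finitely many of the conditions are satisfied by one sufficiently long geodesic.
\<close>

lemma geodesic_ray_limit:
  fixes S :: "'a::metric_space set"
  assumes proper: "proper_space TYPE('a)"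
    and S: "closed S"
    and long: "\<And>N. \<exists>L\<ge>N. \<exists>\<gamma>. geodesic_on {0..L} \<gamma> \<and> \<gamma> 0 = x \<and> \<gamma> ` {0..L} \<subseteq> S"
  obtains \<gamma> where "geodesic_ray \<gamma>" "\<gamma> 0 = x" "\<gamma> ` {0..} \<subseteq> S"
proof -
  define K where "K = Pi\<^sub>E UNIV (\<lambda>t::real. cball x \<bar>t\<bar>)"
  define C where "C = (\<lambda>(s, t). {g :: real \<Rightarrow> 'a. dist (g s) (g t) = \<bar>t - s\<bar> \<and> g s \<in> S})"
  have "compact K"
    unfolding K_def using proper by (intro compact_PiE_UNIV) (auto simp: proper_space_def)
  have ev: "continuous_on UNIV (\<lambda>g :: real \<Rightarrow> 'a. g s)" for s
    by (rule continuous_on_product_coordinates)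
  have "closed (C i)" for i
  proof -
    obtain s t where i: "i = (s, t)" by force
    have "closed {g :: real \<Rightarrow> 'a. dist (g s) (g t) = \<bar>t - s\<bar>}"
      by (intro closed_Collect_eq continuous_intros ev)
    moreover have "closed {g :: real \<Rightarrow> 'a. g s \<in> S}"
      using closed_vimage[OF S ev[of s]] by (simp add: vimage_def)
    ultimately show ?thesis
      by (simp add: C_def i closed_Collect_conj)
  qed
  moreover have "K \<inter> (\<Inter>i\<in>J. C i) \<noteq> {}" if "finite J" "J \<subseteq> {0..} \<times> {0..}" for J
  proof -
    define N where "N = Max (insert 0 (fst ` J \<union> snd ` J))"
    obtain L \<gamma> where L: "N \<le> L" and \<gamma>: "geodesic_on {0..L} \<gamma>" "\<gamma> 0 = x" "\<gamma> ` {0..L} \<subseteq> S"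
      using long by blast
    have "0 \<le> N" unfolding N_def using that by (intro Max_ge) auto
    have N: "s \<in> {0..L} \<and> t \<in> {0..L}" if "(s, t) \<in> J" for s t
    proof -
      have "s \<le> N" "t \<le> N"
        unfolding N_def using \<open>finite J\<close> that by (auto intro!: Max_ge simp: image_iff) force+
      then show ?thesis using L that \<open>J \<subseteq> _\<close> by auto
    qed
    \<comment> \<open>Freezing the geodesic outside \<open>{0..L}\<close> keeps it in \<open>K\<close>.\<close>
    define g where "g = (\<lambda>t. \<gamma> (max 0 (min t L)))"
    have "g \<in> K"
      using geodesic_onD[OF \<gamma>(1), of 0] \<gamma>(2) L \<open>0 \<le> N\<close> by (auto simp: K_def g_def)
    moreover have "g \<in> C i" if "i \<in> J" for i
      using N that geodesic_onD[OF \<gamma>(1)] \<gamma>(3) by (cases i) (auto simp: C_def g_def)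
    ultimately show ?thesis by blast
  qed
  ultimately have "K \<inter> (\<Inter>i\<in>{0..} \<times> {0..}. C i) \<noteq> {}"
    by (rule compact_imp_fip_image[OF \<open>compact K\<close>])
  then obtain \<gamma> where "\<gamma> \<in> K" and \<gamma>: "\<And>s t. 0 \<le> s \<Longrightarrow> 0 \<le> t \<Longrightarrow> \<gamma> \<in> C (s, t)"
    by blast
  have "\<gamma> 0 \<in> cball x \<bar>0\<bar>" using \<open>\<gamma> \<in> K\<close> unfolding K_def by blast
  then have "\<gamma> 0 = x" by simp
  moreover have "geodesic_ray \<gamma>"
    using \<gamma> unfolding geodesic_ray_def geodesic_on_def by (auto simp: C_def is_interval_ci)
  moreover have "\<gamma> ` {0..} \<subseteq> S" using \<gamma> by (auto simp: C_def)
  ultimately show ?thesis using that by blast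
qed

section \<open>Non-elliptic isometries fix a boundary point\<close>

lemma isometry_dist: "isometry f \<Longrightarrow> dist (f x) (f y) = dist x y"
  by (simp add: isometry_def)

lemma isometry_funpow_dist: "isometry f \<Longrightarrow> dist ((f ^^ n) x) ((f ^^ n) y) = dist x y"
  by (induction n) (simp_all add: isometry_dist)

lemma isometry_geodesic_on:
  assumes "isometry f" "geodesic_on I \<gamma>"
  shows "geodesic_on I (f \<circ> \<gamma>)"
  using assms by (simp add: geodesic_on_def isometry_dist)

lemma isometry_closed_sublevel_displacement:
  assumes "isometry f"
  shows "closed {y. dist y (f y) \<le> C}"
proof -
  have "continuous_on UNIV f"
    using assms unfolding continuous_on_iff isometry_def by auto
  then show ?thesis
    by (intro closed_Collect_le continuous_intros)
qed

lemma non_elliptic_boundary_fixed_point: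
  fixes f :: "'a::metric_space \<Rightarrow> 'a"
  assumes proper: "proper_space TYPE('a)" and geo: "geodesic_space TYPE('a)"
    and hyp: "gromov_hyperbolic TYPE('a)"
    and f: "isometry f" and nell: "\<not> elliptic f"
  obtains \<gamma> where "geodesic_ray \<gamma>" "asymptotic (f \<circ> \<gamma>) \<gamma>"
proof -
  obtain \<delta> where \<delta>: "0 \<le> \<delta>"
    and thin: "\<And>A B C :: 'a set. geodesic_triangle A B C \<Longrightarrow> A \<subseteq> nbhd \<delta> (B \<union> C)"
    using hyp unfolding gromov_hyperbolic_def by meson
  fix x :: 'a
  define M where "M = 4 * \<delta> + 3 * dist x (f x)"
  have long: "\<exists>L\<ge>N. \<exists>\<gamma>. geodesic_on {0..L} \<gamma> \<and> \<gamma> 0 = x \<and> \<gamma> ` {0..L} \<subseteq> {y. dist y (f y) \<le> M}" for N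
  proof -
    have "\<not> bounded (range (\<lambda>n. (f ^^ n) x))"
      using nell unfolding elliptic_def by blast
    then obtain n where n: "N < dist x ((f ^^ n) x)"
      unfolding bounded_def by (metis not_less rangeE)
    obtain \<gamma> where \<gamma>: "geodesic_on {0..dist x ((f ^^ n) x)} \<gamma>" "\<gamma> 0 = x"
      "\<gamma> (dist x ((f ^^ n) x)) = (f ^^ n) x"
      using geodesic_of_length_dist[OF geo] by blast
    have "dist ((f ^^ n) x) (f ((f ^^ n) x)) = dist x (f x)"
      using isometry_funpow_dist[OF f, of n x "f x"] by (simp add: funpow_swap1)
    then have "dist (\<gamma> t) ((f \<circ> \<gamma>) t) \<le> M" if "t \<in> {0..dist x ((f ^^ n) x)}" for t
      unfolding M_def
      using geodesic_quadrilateral[OF geo thin \<delta> \<gamma>(1) isometry_geodesic_on[OF f \<gamma>(1)] _ _ that,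
          of "dist x (f x)"] \<gamma> by simp
    then show ?thesis using n \<gamma> by (intro exI[of _ "dist x ((f ^^ n) x)"] conjI exI[of _ \<gamma>]) auto
  qed
  obtain \<gamma> where \<gamma>: "geodesic_ray \<gamma>" "\<gamma> ` {0..} \<subseteq> {y. dist y (f y) \<le> M}"
    using geodesic_ray_limit[OF proper isometry_closed_sublevel_displacement[OF f] long] by blast
  have "asymptotic (f \<circ> \<gamma>) \<gamma>"
    unfolding asymptotic_def
    using \<gamma>(2) by (intro bdd_aboveI[of _ M]) (auto simp: dist_commute)
  then show ?thesis using that \<gamma> by blast
qed

section \<open>Busemann functions and displacement\<close>

text \<open>
  The function under the limit is nonincreasing and bounded below on \<open>{0..}\<close>, both by the triangle
  inequality. Its limit is the Busemann function of the ray.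
\<close>

lemma busemann_limit_exists:
  assumes \<gamma>: "geodesic_ray \<gamma>"
  obtains h where "\<And>y. ((\<lambda>t. dist y (\<gamma> t) - t) \<longlongrightarrow> h y) at_top"
proof -
  define b where "b = (\<lambda>y t. dist y (\<gamma> t) - t)"
  have "(b y \<longlongrightarrow> (INF t\<in>{0..}. b y t)) at_top" for y
  proof -
    have anti: "b y t \<le> b y s" if "0 \<le> s" "s \<le> t" for s t
      using geodesic_rayD[OF \<gamma>, of s t] dist_triangle[of y "\<gamma> t" "\<gamma> s"] that by (simp add: b_def)
    have "- dist y (\<gamma> 0) \<le> b y t" if "0 \<le> t" for t
      using geodesic_rayD[OF \<gamma>, of 0 t] dist_triangle[of "\<gamma> 0" "\<gamma> t" y] that
      by (simp add: b_def dist_commute)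
    then have bdd: "bdd_below (b y ` {0..})" by (intro bdd_belowI2) auto
    show ?thesis
    proof (rule order_tendstoI)
      fix a assume "a < (INF t\<in>{0..}. b y t)"
      then have "a < b y t" if "0 \<le> t" for t
        using cINF_lower[OF bdd, of t] that by simp
      then show "\<forall>\<^sub>F t in at_top. a < b y t"
        using eventually_ge_at_top[of 0] by (rule eventually_mono[rotated])
    next
      fix a assume "(INF t\<in>{0..}. b y t) < a"
      then obtain s where s: "0 \<le> s" "b y s < a"
        using cINF_less_iff[OF _ bdd] by auto
      show "\<forall>\<^sub>F t in at_top. b y t < a"
        using eventually_ge_at_top[of s] by eventually_elim (use anti s in fastforce)
    qed
  qed
  then show ?thesis using that[of "\<lambda>y. INF t\<in>{0..}. b y t"] unfolding b_def by blast
qed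

text \<open>
  Along the ray \<open>f\<close> is nearly the translation by \<open>T\<close>, so the Busemann function \<open>h\<close> of
  the ray satisfies \<open>h (f y) = h y - T\<close>. Since \<open>h\<close> is \<open>1\<close>-Lipschitz, the change \<open>n * T\<close> of its value
  over \<open>n\<close> steps is a lower bound for the distance travelled.
\<close>

lemma almost_translated_displacement:
  assumes f: "isometry f" and \<gamma>: "geodesic_ray \<gamma>"
    and lim: "((\<lambda>t. dist (f (\<gamma> t)) (\<gamma> (t + T))) \<longlongrightarrow> 0) at_top"
  shows "real n * \<bar>T\<bar> \<le> dist y ((f ^^ n) y)"
proof -
  obtain h where h: "\<And>y. ((\<lambda>t. dist y (\<gamma> t) - t) \<longlongrightarrow> h y) at_top"
    using busemann_limit_exists[OF \<gamma>] by blast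
  have lip: "\<bar>h y - h z\<bar> \<le> dist y z" for y z
  proof -
    have "((\<lambda>t. \<bar>(dist y (\<gamma> t) - t) - (dist z (\<gamma> t) - t)\<bar>) \<longlongrightarrow> \<bar>h y - h z\<bar>) at_top"
      by (intro tendsto_intros h)
    then show ?thesis
    proof (rule tendsto_upperbound)
      have "\<bar>(dist y (\<gamma> t) - t) - (dist z (\<gamma> t) - t)\<bar> \<le> dist y z" for t
        using dist_triangle[of y "\<gamma> t" z] dist_triangle[of z "\<gamma> t" y] by (simp add: dist_commute)
      then show "\<forall>\<^sub>F t in at_top. \<bar>(dist y (\<gamma> t) - t) - (dist z (\<gamma> t) - t)\<bar> \<le> dist y z"
        by simp
    qed simp
  qed
  have step: "h (f y) = h y - T" for y
  proof -
    have "filterlim (\<lambda>t. t + T) at_top at_top"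
      by (rule filterlim_tendsto_add_at_top[OF tendsto_const filterlim_ident, of T, unfolded add.commute[of T]])
    then have "((\<lambda>t. (dist (f y) (\<gamma> (t + T)) - (t + T)) - (dist y (\<gamma> t) - t)) \<longlongrightarrow> h (f y) - h y) at_top"
      by (intro tendsto_diff h filterlim_compose[OF h])
    moreover have "((\<lambda>t. (dist (f y) (\<gamma> (t + T)) - (t + T)) - (dist y (\<gamma> t) - t)) \<longlongrightarrow> - T) at_top"
    proof (rule Lim_transform)
      show "((\<lambda>t. - T) \<longlongrightarrow> - T) at_top" by simp
      have "\<bar>dist (f y) (\<gamma> (t + T)) - dist y (\<gamma> t)\<bar> \<le> dist (f (\<gamma> t)) (\<gamma> (t + T))" for t
        using dist_triangle[of "f y" "\<gamma> (t + T)" "f (\<gamma> t)"]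
          dist_triangle[of "f y" "f (\<gamma> t)" "\<gamma> (t + T)"] isometry_dist[OF f, of y "\<gamma> t"]
        by (simp add: dist_commute)
      then show "((\<lambda>t. (dist (f y) (\<gamma> (t + T)) - (t + T)) - (dist y (\<gamma> t) - t) - - T) \<longlongrightarrow> 0) at_top"
        by (intro Lim_null_comparison[OF _ lim]) (simp add: algebra_simps)
    qed
    ultimately have "h (f y) - h y = - T"
      by (rule tendsto_unique[OF trivial_limit_at_top_linorder])
    then show ?thesis by simp
  qed
  have "h ((f ^^ n) y) = h y - real n * T"
    by (induction n) (simp_all add: step algebra_simps)
  then show ?thesis
    using lip[of y "(f ^^ n) y"] by (simp add: abs_mult)
qed

lemma almost_translated_ray_displacement:
  assumes \<gamma>: "geodesic_ray \<gamma>"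
    and lim: "((\<lambda>t. dist (f (\<gamma> t)) (\<gamma> (t + T))) \<longlongrightarrow> 0) at_top"
  shows "((\<lambda>t. dist (\<gamma> t) (f (\<gamma> t))) \<longlongrightarrow> \<bar>T\<bar>) at_top"
proof (rule Lim_transform)
  show "((\<lambda>t. \<bar>T\<bar>) \<longlongrightarrow> \<bar>T\<bar>) at_top" by simp
  have "\<forall>\<^sub>F t in at_top. norm (dist (\<gamma> t) (f (\<gamma> t)) - \<bar>T\<bar>) \<le> dist (f (\<gamma> t)) (\<gamma> (t + T))"
    using eventually_ge_at_top[of "\<bar>T\<bar>"]
  proof eventually_elim
    case (elim t)
    then have "dist (\<gamma> t) (\<gamma> (t + T)) = \<bar>T\<bar>"
      using geodesic_rayD[OF \<gamma>, of t "t + T"] by simp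
    then show ?case
      using dist_triangle[of "\<gamma> t" "f (\<gamma> t)" "\<gamma> (t + T)"]
        dist_triangle[of "\<gamma> t" "\<gamma> (t + T)" "f (\<gamma> t)"] by (simp add: dist_commute)
  qed
  then show "((\<lambda>t. dist (\<gamma> t) (f (\<gamma> t)) - \<bar>T\<bar>) \<longlongrightarrow> 0) at_top"
    by (rule Lim_null_comparison[OF _ lim])
qed

section \<open>The divergence rate\<close>

lemma isometry_orbit_dist_le:
  assumes f: "isometry f"
  shows "dist x ((f ^^ n) x) \<le> 2 * dist x y + real n * dist y (f y)"
proof -
  have "dist y ((f ^^ n) y) \<le> real n * dist y (f y)"
  proof (induction n)
    case (Suc n)
    have "dist ((f ^^ n) y) ((f ^^ Suc n) y) = dist y (f y)"
      using isometry_funpow_dist[OF f, of n y "f y"] by (simp add: funpow_swap1)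
    then show ?case
      using Suc dist_triangle[of y "(f ^^ Suc n) y" "(f ^^ n) y"] by (simp add: algebra_simps)
  qed simp
  then show ?thesis
    using dist_triangle[of x "(f ^^ n) x" y] dist_triangle[of y "(f ^^ n) x" "(f ^^ n) y"]
      isometry_funpow_dist[OF f, of n y x] by (simp add: dist_commute)
qed

text \<open>
  The lower bound on the rate comes from every orbit directly, the upper bound from
  comparing the orbit of \<open>x\<close> with the orbit of a point whose displacement is nearly minimal.
\<close>

lemma divergence_rate_eqI:
  fixes f :: "'a::metric_space \<Rightarrow> 'a"
  assumes f: "isometry f"
    and lower: "\<And>y n. real n * c \<le> dist y ((f ^^ n) y)"
    and upper: "\<And>e. 0 < e \<Longrightarrow> \<exists>y. dist y (f y) < c + e"
  shows "divergence_rate f = c"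
proof -
  have lim: "(\<lambda>n. dist x ((f ^^ n) x) / real n) \<longlonglongrightarrow> c" for x
  proof (rule order_tendstoI)
    fix a assume "a < c"
    show "\<forall>\<^sub>F n in sequentially. a < dist x ((f ^^ n) x) / real n"
      using eventually_gt_at_top[of 0]
    proof eventually_elim
      case (elim n)
      then have "c \<le> dist x ((f ^^ n) x) / real n"
        using lower[of n x] by (simp add: pos_le_divide_eq mult.commute)
      then show ?case using \<open>a < c\<close> by simp
    qed
  next
    fix a assume "c < a"
    then obtain y where y: "dist y (f y) < a" using upper[of "a - c"] by auto
    have "(\<lambda>n. 2 * dist x y / real n + dist y (f y)) \<longlonglongrightarrow> 0 + dist y (f y)"
      by (intro tendsto_intros lim_const_over_n)
    then have "\<forall>\<^sub>F n in sequentially. 2 * dist x y / real n + dist y (f y) < a"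
      using y by (auto dest: order_tendstoD)
    then show "\<forall>\<^sub>F n in sequentially. dist x ((f ^^ n) x) / real n < a"
      using eventually_gt_at_top[of 0]
    proof eventually_elim
      case (elim n)
      then have "dist x ((f ^^ n) x) / real n \<le> 2 * dist x y / real n + dist y (f y)"
        using isometry_orbit_dist_le[OF f, of x n y] by (simp add: field_simps)
      then show ?case using elim by simp
    qed
  qed
  show ?thesis
    unfolding divergence_rate_def
  proof (rule the_equality)
    show "\<And>c'. \<forall>x. (\<lambda>n. dist x ((f ^^ n) x) / real n) \<longlonglongrightarrow> c' \<Longrightarrow> c' = c"
      using lim LIMSEQ_unique by blast
  qed (use lim in blast)
qed

theorem corollary4p11:
  fixes f :: "'a::metric_space \<Rightarrow> 'a"
  assumes "proper_space TYPE('a)"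
    and "geodesic_space TYPE('a)"
    and "gromov_hyperbolic TYPE('a)"
    and "approaching_geodesics TYPE('a)"
    and "isometry f"
    and "\<not> elliptic f"
  shows "minimal_displacement f = divergence_rate f"
proof -
  obtain \<gamma> where \<gamma>: "geodesic_ray \<gamma>" "asymptotic (f \<circ> \<gamma>) \<gamma>"
    using non_elliptic_boundary_fixed_point assms by blast
  have "geodesic_ray (f \<circ> \<gamma>)"
    using isometry_geodesic_on[OF \<open>isometry f\<close>] \<gamma>(1) unfolding geodesic_ray_def .
  then obtain T where T: "((\<lambda>t. dist (f (\<gamma> t)) (\<gamma> (t + T))) \<longlongrightarrow> 0) at_top"
    using \<open>approaching_geodesics TYPE('a)\<close> \<gamma>
    unfolding approaching_geodesics_def strongly_asymptotic_def by fastforce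
  note lower = almost_translated_displacement[OF \<open>isometry f\<close> \<gamma>(1) T]
  have upper: "\<exists>y. dist y (f y) < \<bar>T\<bar> + e" if "0 < e" for e
  proof -
    have "\<forall>\<^sub>F t in at_top. dist (\<gamma> t) (f (\<gamma> t)) < \<bar>T\<bar> + e"
      using order_tendstoD(2)[OF almost_translated_ray_displacement[OF \<gamma>(1) T]] that by simp
    then show ?thesis
      using eventually_happens'[OF trivial_limit_at_top_linorder] by blast
  qed
  have "minimal_displacement f = \<bar>T\<bar>"
    unfolding minimal_displacement_def
  proof (rule cInf_eq)
    show "\<bar>T\<bar> \<le> r" if "r \<in> range (\<lambda>x. dist x (f x))" for r
      using that lower[of 1] by auto
    show "r \<le> \<bar>T\<bar>" if "\<And>d. d \<in> range (\<lambda>x. dist x (f x)) \<Longrightarrow> r \<le> d" for r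
    proof (rule field_le_epsilon)
      fix e :: real assume "0 < e"
      then show "r \<le> \<bar>T\<bar> + e" using upper that by (metis less_imp_le order_trans rangeI)
    qed
  qed
  moreover have "divergence_rate f = \<bar>T\<bar>"
    by (rule divergence_rate_eqI[OF \<open>isometry f\<close> lower upper])
  ultimately show ?thesis by simp
qed

end
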